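(* A Hilbert space is weakly proper. In particular, on a Hilbert space the usual weak topology coincides with $\tau_w$.
   Context: A Hilbert space is regarded as a Hadamard space (complete $\mathrm{CAT}(0)$ space) with the metric $d(x,y)=\|x-y\|$. For a Hadamard space $(H,d)$ and $x\in H$, $\Gamma_x(H)$ is the set of all constant speed geodesics $\gamma:[0,1]\to H$ (i.e. $d(\gamma(s),\gamma(t))=|s-t|\,d(\gamma(0),\gamma(1))$ for all $s,t\in[0,1]$) with $\gamma(0)=x$. For a geodesic $\gamma$, $P_\gamma$ denotes the metric projection onto (the image of) $\gamma$. Elementary sets: for $x\in H$, $\gamma\in\Gamma_x(H)$, $\varepsilon>0$, $U_x(\varepsilon;\gamma):=\{y\in H: d(x,P_\gamma y)<\varepsilon\}$; also $U_x(\varepsilon;\gamma_1,\dots,\gamma_n):=\bigcap_{i=1}^n U_x(\varepsilon;\gamma_i)$. Weak topology $\tau_w$: a set $U\subset H$ is weakly open if for every $x\in U$ there exist $\varepsilon>0$ and finitely many $\gamma_1,\dots,\gamma_n\in\Gamma_x(H)$ with $U_x(\varepsilon;\gamma_1,\dots,\gamma_n)\subseteq U$. The weakly open sets (together with $\emptyset$) form the topology $\tau_w$ on $H$. $H$ is weakly proper if for every $x\in H$, every $\gamma\in\Gamma_x(H)$ and every $\varepsilon>0$ there exists $V\in\tau_w$ with $x\in V\subseteq U_x(\varepsilon;\gamma)$. *)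

theory Defs
  imports "HOL-Analysis.Analysis"
begin

definition geodesics_from :: "'a::metric_space \<Rightarrow> (real \<Rightarrow> 'a) set" where
  "geodesics_from x =
     {\<gamma>. \<gamma> 0 = x \<and>
          (\<forall>s\<in>{0..1}. \<forall>t\<in>{0..1}. dist (\<gamma> s) (\<gamma> t) = \<bar>s - t\<bar> * dist (\<gamma> 0) (\<gamma> 1))}"

text \<open>The image of a geodesic is compact and, in a Hadamard space, convex, so the nearest point
  exists and is unique there; in other metric spaces the definite description may be
  unspecified. The library's closest point function is restricted to Heine-Borel spaces.\<close>

definition metric_proj :: "'a::metric_space set \<Rightarrow> 'a \<Rightarrow> 'a" where
  "metric_proj C y = (THE p. p \<in> C \<and> (\<forall>q\<in>C. dist y p \<le> dist y q))"

text \<open>Geodesics are total functions on the reals of which only the restriction to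
  \<open>{0..1}\<close> matters; hence the projection is onto \<open>\<gamma> ` {0..1}\<close>.\<close>

definition elementary_set :: "'a::metric_space \<Rightarrow> real \<Rightarrow> (real \<Rightarrow> 'a) \<Rightarrow> 'a set" where
  "elementary_set x \<epsilon> \<gamma> = {y. dist x (metric_proj (\<gamma> ` {0..1}) y) < \<epsilon>}"

definition weakly_open :: "'a::metric_space set \<Rightarrow> bool" where
  "weakly_open U \<longleftrightarrow>
     (\<forall>x\<in>U. \<exists>\<epsilon>>0. \<exists>G. finite G \<and> G \<noteq> {} \<and> G \<subseteq> geodesics_from x \<and>
        (\<Inter>\<gamma>\<in>G. elementary_set x \<epsilon> \<gamma>) \<subseteq> U)"

lemma istopology_weakly_open: "istopology (weakly_open :: 'a::metric_space set \<Rightarrow> bool)"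
  unfolding istopology_def
proof (intro conjI allI impI)
  fix S T :: "'a set"
  assume S: "weakly_open S" and T: "weakly_open T"
  show "weakly_open (S \<inter> T)"
    unfolding weakly_open_def
  proof
    fix x assume x: "x \<in> S \<inter> T"
    obtain d G where G: "d > 0" "finite G" "G \<noteq> {}" "G \<subseteq> geodesics_from x"
        "(\<Inter>\<gamma>\<in>G. elementary_set x d \<gamma>) \<subseteq> S"
      using S x unfolding weakly_open_def by (metis IntD1)
    obtain e F where F: "e > 0" "finite F" "F \<noteq> {}" "F \<subseteq> geodesics_from x"
        "(\<Inter>\<gamma>\<in>F. elementary_set x e \<gamma>) \<subseteq> T"
      using T x unfolding weakly_open_def by (metis IntD2)
    have "elementary_set x (min d e) \<gamma> \<subseteq> elementary_set x d \<gamma> \<inter> elementary_set x e \<gamma>" for \<gamma>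
      unfolding elementary_set_def by auto
    then have "(\<Inter>\<gamma>\<in>G \<union> F. elementary_set x (min d e) \<gamma>) \<subseteq>
        (\<Inter>\<gamma>\<in>G. elementary_set x d \<gamma>) \<inter> (\<Inter>\<gamma>\<in>F. elementary_set x e \<gamma>)"
      by fast
    also have "\<dots> \<subseteq> S \<inter> T"
      using G(5) F(5) by (rule Int_mono)
    finally have "(\<Inter>\<gamma>\<in>G \<union> F. elementary_set x (min d e) \<gamma>) \<subseteq> S \<inter> T" .
    moreover have "min d e > 0" "finite (G \<union> F)" "G \<union> F \<noteq> {}" "G \<union> F \<subseteq> geodesics_from x"
      using G F by auto
    ultimately show "\<exists>\<epsilon>>0. \<exists>G. finite G \<and> G \<noteq> {} \<and> G \<subseteq> geodesics_from x \<and>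
        (\<Inter>\<gamma>\<in>G. elementary_set x \<epsilon> \<gamma>) \<subseteq> S \<inter> T"
      by (intro exI[of _ "min d e"] exI[of _ "G \<union> F"] conjI)
  qed
next
  fix \<K> :: "'a set set"
  assume K: "\<forall>S\<in>\<K>. weakly_open S"
  show "weakly_open (\<Union>\<K>)"
    unfolding weakly_open_def
  proof
    fix x assume "x \<in> \<Union>\<K>"
    then obtain S where S: "S \<in> \<K>" "x \<in> S" by blast
    then obtain d G where G: "d > 0" "finite G" "G \<noteq> {}" "G \<subseteq> geodesics_from x"
        "(\<Inter>\<gamma>\<in>G. elementary_set x d \<gamma>) \<subseteq> S"
      using K unfolding weakly_open_def by metis
    have "(\<Inter>\<gamma>\<in>G. elementary_set x d \<gamma>) \<subseteq> \<Union>\<K>"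
      using G(5) Union_upper[OF S(1)] by (rule subset_trans)
    with G(1-4) show "\<exists>\<epsilon>>0. \<exists>G. finite G \<and> G \<noteq> {} \<and> G \<subseteq> geodesics_from x \<and>
        (\<Inter>\<gamma>\<in>G. elementary_set x \<epsilon> \<gamma>) \<subseteq> \<Union>\<K>"
      by (intro exI[of _ d] exI[of _ G] conjI)
  qed
qed

definition tau_w :: "'a::metric_space topology" where
  "tau_w = topology weakly_open"

lemma openin_tau_w: "openin tau_w U \<longleftrightarrow> weakly_open U"
  unfolding tau_w_def by (simp only: topology_inverse'[OF istopology_weakly_open])

definition weakly_proper :: "'a::metric_space itself \<Rightarrow> bool" where
  "weakly_proper TYPE('a) \<longleftrightarrow>
     (\<forall>x::'a. \<forall>\<gamma>\<in>geodesics_from x. \<forall>\<epsilon>>0.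
        \<exists>V. openin tau_w V \<and> x \<in> V \<and> V \<subseteq> elementary_set x \<epsilon> \<gamma>)"

text \<open>The usual weak topology: the coarsest one making every continuous linear functional
  continuous.\<close>

definition weak_topology :: "'a::real_normed_vector topology" where
  "weak_topology =
     topology_generated_by {f -` U | (f :: 'a \<Rightarrow> real) U. bounded_linear f \<and> open U}"

end

theory Submission
  imports Defs
begin

text \<open>
  The whole argument rests on one computation: in an inner product space an elementary set
  \<open>U\<^sub>x(\<epsilon>;\<gamma>)\<close> is either the whole space or an open half-space whose normal is the direction
  \<open>v = \<gamma> 1 - x\<close> of \<open>\<gamma>\<close> (lemma \<open>elementary_set_eq\<close>). Indeed strict convexity of the norm makes a
  geodesic an affine segment, and the nearest point of that segment to \<open>y\<close> is obtained by
  projecting \<open>y\<close> orthogonally to the line through \<open>x\<close> and clamping the parameter to \<open>[0,1]\<close>.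

  Conversely, every half-space \<open>{y. y \<bullet> v < c}\<close> contains, around each of its points \<open>z\<close>, an
  elementary set based at \<open>z\<close> and pointing in the direction \<open>v\<close>. So half-spaces are
  \<open>\<tau>\<^sub>w\<close>-open (lemma \<open>weakly_open_halfspace\<close>), elementary sets are themselves \<open>\<tau>\<^sub>w\<close>-open, and
  weak properness follows.

  For the second claim, elementary sets are open in the usual weak topology because \<open>y \<mapsto> y \<bullet> v\<close>
  is a bounded functional. For the other inclusion the Riesz representation theorem writes every
  bounded functional as an inner product, so that preimages of intervals are intersections
  of two half-spaces. This is the only place where completeness enters.
\<close>

section \<open>The Riesz representation theorem\<close>

text \<open>The representing vector is the minimiser of the energy \<open>Q x = \<parallel>x\<parallel>\<^sup>2/2 - f x\<close>. A minimising
  sequence is Cauchy by the parallelogram law, and the vanishing of the first variation of \<open>Q\<close> at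
  the minimiser is the desired identity.\<close>

theorem riesz_representation:
  fixes f :: "'a::{real_inner,complete_space} \<Rightarrow> real"
  assumes "bounded_linear f"
  obtains v where "\<And>x. f x = x \<bullet> v"
proof -
  interpret f: bounded_linear f by fact
  define Q where "Q = (\<lambda>x. x \<bullet> x / 2 - f x)"
  obtain K where K: "\<And>x. norm (f x) \<le> norm x * K"
    using f.bounded by blast
  have "- K\<^sup>2 / 2 \<le> Q x" for x
  proof -
    have "0 \<le> (norm x - K)\<^sup>2" by simp
    also have "\<dots> = x \<bullet> x - 2 * (norm x * K) + K\<^sup>2"
      by (simp add: power2_diff dot_square_norm)
    finally show ?thesis
      using K[of x] by (simp add: Q_def)
  qed
  then have bdd: "bdd_below (range Q)"
    by (intro bdd_belowI2)
  define m where "m = Inf (range Q)"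
  have m_le: "m \<le> Q x" for x
    unfolding m_def using bdd by (simp add: cInf_lower)
  have "\<exists>x. Q x < m + 1 / real (Suc n)" for n
    using cInf_lessD[of "range Q" "m + 1 / real (Suc n)"] by (auto simp: m_def)
  then obtain X where X: "\<And>n. Q (X n) < m + 1 / real (Suc n)"
    by metis
  have gap: "(dist x y)\<^sup>2 \<le> 4 * (Q x - m) + 4 * (Q y - m)" for x y
  proof -
    have "(dist x y)\<^sup>2 = 4 * (Q x + Q y - 2 * Q ((1/2) *\<^sub>R (x + y)))"
      by (simp add: Q_def dist_norm power2_norm_eq_inner f.add f.scaleR inner_commute
          algebra_simps)
    with m_le[of "(1/2) *\<^sub>R (x + y)"] show ?thesis
      by (simp add: algebra_simps)
  qed
  have "Cauchy X"
  proof (rule metric_CauchyI)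
    fix e :: real
    assume "0 < e"
    then obtain N where N: "8 / e\<^sup>2 < real N"
      using reals_Archimedean2 by blast
    have "dist (X i) (X j) < e" if "i \<ge> N" "j \<ge> N" for i j
    proof -
      have small: "Q (X k) - m < e\<^sup>2 / 8" if "k \<ge> N" for k
      proof -
        have "8 / e\<^sup>2 < real (Suc k)" using N that by simp
        then have "1 / real (Suc k) < e\<^sup>2 / 8"
          using \<open>0 < e\<close> by (simp add: field_simps del: of_nat_Suc)
        with X[of k] show ?thesis by simp
      qed
      have "(dist (X i) (X j))\<^sup>2 < e\<^sup>2"
        using gap[of "X i" "X j"] small[OF that(1)] small[OF that(2)] by simp
      then show ?thesis
        using \<open>0 < e\<close> by (simp add: power_less_imp_less_base)
    qed
    then show "\<exists>N. \<forall>i\<ge>N. \<forall>j\<ge>N. dist (X i) (X j) < e" by blast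
  qed
  then obtain v where v: "X \<longlonglongrightarrow> v"
    using Cauchy_convergent convergent_def by blast
  have "(\<lambda>n. Q (X n)) \<longlonglongrightarrow> Q v"
    unfolding Q_def using v by (intro tendsto_intros f.tendsto) auto
  moreover have "(\<lambda>n. m + 1 / real (Suc n)) \<longlonglongrightarrow> m + 0"
    by (intro tendsto_intros LIMSEQ_Suc lim_1_over_n)
  ultimately have "Q v \<le> m + 0"
    by (rule LIMSEQ_le) (use X less_imp_le in blast)
  then have min: "Q v \<le> Q x" for x
    using m_le[of x] by simp
  have "f h = h \<bullet> v" for h
  proof (rule ccontr)
    define d where "d = f h - h \<bullet> v"
    assume "f h \<noteq> h \<bullet> v"
    then have "d \<noteq> 0" by (simp add: d_def)
    then have "h \<noteq> 0" by (auto simp: d_def f.zero)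
    then have hh: "h \<bullet> h > 0" by simp
    \<comment> \<open>The step \<open>t\<close> minimises the quadratic polynomial \<open>t \<mapsto> Q (v + t h)\<close>.\<close>
    define t where "t = d / (h \<bullet> h)"
    have "Q (v + t *\<^sub>R h) - Q v = t\<^sup>2 * (h \<bullet> h) / 2 - t * d"
      by (simp add: Q_def d_def f.add f.scaleR inner_commute power2_eq_square algebra_simps)
    also have "\<dots> = - d\<^sup>2 / (2 * (h \<bullet> h))"
      using hh by (simp add: t_def power2_eq_square field_simps)
    also have "\<dots> < 0"
      using hh \<open>d \<noteq> 0\<close> by simp
    finally show False
      using min[of "v + t *\<^sub>R h"] by simp
  qed
  then show thesis by (rule that)
qed

section \<open>Elementary sets of an inner product space\<close>

text \<open>Equality in the triangle inequality at \<open>\<gamma> t\<close> forces \<open>\<gamma> t - x\<close> to be a multiple of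
  \<open>\<gamma> 1 - x\<close>, by expanding the squared distances.\<close>

lemma geodesic_affine:
  fixes x :: "'a::real_inner"
  assumes "\<gamma> \<in> geodesics_from x" and t: "t \<in> {0..1}"
  shows "\<gamma> t = x + t *\<^sub>R (\<gamma> 1 - x)"
proof -
  define v w where "v = \<gamma> 1 - x" and "w = \<gamma> t - x"
  have x: "\<gamma> 0 = x"
    and geo: "\<And>s t. \<lbrakk>s \<in> {0..1}; t \<in> {0..1}\<rbrakk> \<Longrightarrow> dist (\<gamma> s) (\<gamma> t) = \<bar>s - t\<bar> * dist (\<gamma> 0) (\<gamma> 1)"
    using assms(1) by (auto simp: geodesics_from_def)
  have "norm w = t * norm v"
    using geo[of t 0] t by (simp add: x v_def w_def dist_norm norm_minus_commute)
  then have w: "w \<bullet> w = t\<^sup>2 * (v \<bullet> v)"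
    by (metis power2_norm_eq_inner power_mult_distrib)
  have "norm (w - v) = (1 - t) * norm v"
    using geo[of t 1] t by (simp add: x v_def w_def dist_norm norm_minus_commute)
  then have "(w - v) \<bullet> (w - v) = (1 - t)\<^sup>2 * (v \<bullet> v)"
    by (metis power2_norm_eq_inner power_mult_distrib)
  with w have wv: "w \<bullet> v = t * (v \<bullet> v)"
    by (simp add: inner_commute power2_eq_square algebra_simps)
  have "(w - t *\<^sub>R v) \<bullet> (w - t *\<^sub>R v) = w \<bullet> w - 2 * t * (w \<bullet> v) + t\<^sup>2 * (v \<bullet> v)"
    by (simp add: inner_commute power2_eq_square algebra_simps)
  also have "\<dots> = 0"
    by (simp add: w wv power2_eq_square)
  finally have "w = t *\<^sub>R v"
    by simp
  then show ?thesis
    by (simp add: v_def w_def diff_eq_eq add.commute)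
qed

lemma affine_geodesic: "(\<lambda>t. x + t *\<^sub>R v) \<in> geodesics_from (x::'a::real_inner)"
  by (auto simp: geodesics_from_def dist_norm simp flip: scaleR_left_diff_distrib)

text \<open>Along the line through \<open>x\<close> and \<open>x + v\<close> the squared distance from \<open>y\<close> is a quadratic
  polynomial in the parameter with apex \<open>((y - x) \<bullet> v) / (v \<bullet> v)\<close>, so its minimum over
  \<open>[0,1]\<close> is at the clamped apex. For \<open>v = 0\<close> the apex is \<open>0\<close> by the convention on division,
  and the only point \<open>x\<close> of the segment is returned correctly.\<close>

lemma metric_proj_segment:
  fixes x :: "'a::real_inner"
  shows "metric_proj ((\<lambda>t. x + t *\<^sub>R v) ` {0..1}) y =
           x + max 0 (min 1 (((y - x) \<bullet> v) / (v \<bullet> v))) *\<^sub>R v"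
proof -
  define a where "a = ((y - x) \<bullet> v) / (v \<bullet> v)"
  define b where "b = max 0 (min 1 a)"
  have b: "b \<in> {0..1}" by (auto simp: b_def)
  have dist_eq: "(dist y (x + t *\<^sub>R v))\<^sup>2 = (y - x) \<bullet> (y - x) - a\<^sup>2 * (v \<bullet> v) + (t - a)\<^sup>2 * (v \<bullet> v)"
    for t
  proof -
    have av: "a * (v \<bullet> v) = (y - x) \<bullet> v"
      by (simp add: a_def)
    have "(dist y (x + t *\<^sub>R v))\<^sup>2 = ((y - x) - t *\<^sub>R v) \<bullet> ((y - x) - t *\<^sub>R v)"
      by (simp add: dist_norm power2_norm_eq_inner diff_diff_add)
    also have "\<dots> = (y - x) \<bullet> (y - x) - 2 * t * ((y - x) \<bullet> v) + t\<^sup>2 * (v \<bullet> v)"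
      by (simp add: inner_commute power2_eq_square algebra_simps)
    also have "\<dots> = (y - x) \<bullet> (y - x) - 2 * t * (a * (v \<bullet> v)) + t\<^sup>2 * (v \<bullet> v)"
      by (simp only: av)
    finally show ?thesis
      by (simp add: power2_eq_square algebra_simps)
  qed
  have closer: "dist y (x + b *\<^sub>R v) < dist y (x + t *\<^sub>R v)"
    if "t \<in> {0..1}" "x + t *\<^sub>R v \<noteq> x + b *\<^sub>R v" for t
  proof -
    have "t \<noteq> b" "v \<bullet> v > 0" using that by auto
    have "\<bar>b - a\<bar> < \<bar>t - a\<bar>"
      using that(1) \<open>t \<noteq> b\<close> by (auto simp: b_def max_def min_def split: if_splits)
    then have "(b - a)\<^sup>2 < (t - a)\<^sup>2"
      using power_strict_mono[of "\<bar>b - a\<bar>" "\<bar>t - a\<bar>" 2] by simp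
    then have "(dist y (x + b *\<^sub>R v))\<^sup>2 < (dist y (x + t *\<^sub>R v))\<^sup>2"
      using \<open>v \<bullet> v > 0\<close> by (simp add: dist_eq)
    then show ?thesis
      by (simp add: power_less_imp_less_base)
  qed
  have "metric_proj ((\<lambda>t. x + t *\<^sub>R v) ` {0..1}) y = x + b *\<^sub>R v"
    unfolding metric_proj_def
  proof (rule the_equality)
    show "x + b *\<^sub>R v \<in> (\<lambda>t. x + t *\<^sub>R v) ` {0..1} \<and>
        (\<forall>q\<in>(\<lambda>t. x + t *\<^sub>R v) ` {0..1}. dist y (x + b *\<^sub>R v) \<le> dist y q)"
      using b closer less_imp_le by fastforce
  next
    fix p
    assume "p \<in> (\<lambda>t. x + t *\<^sub>R v) ` {0..1} \<and> (\<forall>q\<in>(\<lambda>t. x + t *\<^sub>R v) ` {0..1}. dist y p \<le> dist y q)"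
    then obtain t where "t \<in> {0..1}" "p = x + t *\<^sub>R v" "dist y p \<le> dist y (x + b *\<^sub>R v)"
      using b by blast
    then show "p = x + b *\<^sub>R v"
      using closer[of t] by fastforce
  qed
  then show ?thesis by (simp add: b_def a_def)
qed

text \<open>A geodesic shorter than \<open>\<epsilon>\<close> imposes no condition, since all of its points are within
  \<open>\<epsilon>\<close> of \<open>x\<close>. On a longer one the clamp at \<open>1\<close> does not matter, and the clamp at \<open>0\<close> never does
  because \<open>\<epsilon> > 0\<close>.\<close>

lemma elementary_set_eq:
  fixes x :: "'a::real_inner"
  assumes \<gamma>: "\<gamma> \<in> geodesics_from x" and "\<epsilon> > 0"
  shows "elementary_set x \<epsilon> \<gamma> =
           (if norm (\<gamma> 1 - x) < \<epsilon> then UNIV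
            else {y. y \<bullet> (\<gamma> 1 - x) < x \<bullet> (\<gamma> 1 - x) + \<epsilon> * norm (\<gamma> 1 - x)})"
proof -
  define v where "v = \<gamma> 1 - x"
  define b where "b = (\<lambda>y. max 0 (min 1 (((y - x) \<bullet> v) / (v \<bullet> v))))"
  have "\<gamma> ` {0..1} = (\<lambda>t. x + t *\<^sub>R v) ` {0..1}"
    unfolding v_def by (intro image_cong refl geodesic_affine[OF \<gamma>])
  then have mem: "y \<in> elementary_set x \<epsilon> \<gamma> \<longleftrightarrow> b y * norm v < \<epsilon>" for y
    by (simp add: elementary_set_def metric_proj_segment dist_norm b_def)
  show ?thesis
  proof (cases "norm v < \<epsilon>")
    case True
    have "b y * norm v \<le> 1 * norm v" for y
      by (rule mult_right_mono) (auto simp: b_def)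
    then have "b y * norm v < \<epsilon>" for y
      using True by (metis mult_1 order_le_less_trans)
    then show ?thesis
      using True mem by (auto simp: v_def)
  next
    case False
    then have pos: "norm v > 0" and le: "\<epsilon> / norm v \<le> 1"
      using \<open>\<epsilon> > 0\<close> by (auto simp: divide_le_eq)
    have "b y * norm v < \<epsilon> \<longleftrightarrow> y \<bullet> v < x \<bullet> v + \<epsilon> * norm v" for y
    proof -
      have "b y * norm v < \<epsilon> \<longleftrightarrow> b y < \<epsilon> / norm v"
        using pos by (simp add: less_divide_eq)
      also have "\<dots> \<longleftrightarrow> ((y - x) \<bullet> v) / (v \<bullet> v) < \<epsilon> / norm v"
        using pos le \<open>\<epsilon> > 0\<close> by (auto simp: b_def less_max_iff_disj min_less_iff_disj)
      also have "\<dots> \<longleftrightarrow> (y - x) \<bullet> v < \<epsilon> * norm v"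
        using pos by (simp add: dot_square_norm power2_eq_square field_simps)
      finally show ?thesis
        by (simp add: inner_diff_left algebra_simps)
    qed
    then show ?thesis
      using False mem by (auto simp: v_def)
  qed
qed

section \<open>Half-spaces and the two weak topologies\<close>

lemma weakly_open_halfspace:
  fixes v :: "'a::real_inner"
  shows "weakly_open {y. y \<bullet> v < c}"
  unfolding weakly_open_def
proof
  fix z
  assume "z \<in> {y. y \<bullet> v < c}"
  then have z: "z \<bullet> v < c" by simp
  let ?\<gamma> = "\<lambda>t. z + t *\<^sub>R v"
  \<comment> \<open>The bound \<open>\<epsilon> \<le> \<parallel>v\<parallel>\<close> keeps the elementary set from being the whole space; \<open>v = 0\<close>, where
    the half-space is the whole space, needs a value of its own.\<close>
  define \<epsilon> where "\<epsilon> = (if v = 0 then 1 else min (norm v) ((c - z \<bullet> v) / norm v))"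
  have "\<epsilon> > 0" using z by (simp add: \<epsilon>_def)
  have "\<epsilon> * norm v \<le> c - z \<bullet> v"
  proof (cases "v = 0")
    case False
    then have "\<epsilon> \<le> (c - z \<bullet> v) / norm v" by (simp add: \<epsilon>_def)
    with False show ?thesis by (simp add: le_divide_eq)
  qed (use z in simp)
  moreover have "\<not> norm v < \<epsilon>" if "v \<noteq> 0"
    using that by (simp add: \<epsilon>_def)
  ultimately have "elementary_set z \<epsilon> ?\<gamma> \<subseteq> {y. y \<bullet> v < c}"
    using z by (cases "v = 0") (auto simp: elementary_set_eq[OF affine_geodesic \<open>\<epsilon> > 0\<close>])
  then show "\<exists>\<epsilon>>0. \<exists>G. finite G \<and> G \<noteq> {} \<and> G \<subseteq> geodesics_from z \<and>
      (\<Inter>\<gamma>\<in>G. elementary_set z \<epsilon> \<gamma>) \<subseteq> {y. y \<bullet> v < c}"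
    using \<open>\<epsilon> > 0\<close> affine_geodesic[of z v] by (intro exI[of _ \<epsilon>] exI[of _ "{?\<gamma>}"] conjI) auto
qed

lemma mem_elementary_set:
  fixes x :: "'a::real_inner"
  assumes "\<gamma> \<in> geodesics_from x" "\<epsilon> > 0"
  shows "x \<in> elementary_set x \<epsilon> \<gamma>"
proof -
  have "0 < \<epsilon> * norm (\<gamma> 1 - x)" if "\<epsilon> \<le> norm (\<gamma> 1 - x)"
    using that \<open>\<epsilon> > 0\<close> by (intro mult_pos_pos) linarith+
  then show ?thesis
    by (simp add: elementary_set_eq[OF assms] not_less)
qed

lemma openin_tau_w_elementary_set:
  fixes x :: "'a::real_inner"
  assumes "\<gamma> \<in> geodesics_from x" "\<epsilon> > 0"
  shows "openin tau_w (elementary_set x \<epsilon> \<gamma>)"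
proof -
  have "openin tau_w (UNIV :: 'a set)"
    using weakly_open_halfspace[of "0::'a" 1] by (simp add: openin_tau_w)
  with assms show ?thesis
    by (simp add: elementary_set_eq openin_tau_w weakly_open_halfspace)
qed

lemma openin_weak_topology_vimage:
  fixes f :: "'a::real_normed_vector \<Rightarrow> real"
  assumes "bounded_linear f" "open U"
  shows "openin weak_topology (f -` U)"
  unfolding weak_topology_def
  by (rule topology_generated_by_Basis) (use assms in blast)

lemma openin_weak_topology_elementary_set:
  fixes x :: "'a::real_inner"
  assumes "\<gamma> \<in> geodesics_from x" "\<epsilon> > 0"
  shows "openin weak_topology (elementary_set x \<epsilon> \<gamma>)"
proof -
  have "openin weak_topology ((\<lambda>y. y \<bullet> v) -` {..<c})" for v :: 'a and c
    by (intro openin_weak_topology_vimage bounded_linear_inner_left) simp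
  moreover have "openin weak_topology (UNIV :: 'a set)"
    using openin_weak_topology_vimage[OF bounded_linear_zero open_UNIV] by simp
  ultimately show ?thesis
    using assms by (simp add: elementary_set_eq vimage_def)
qed

text \<open>By Riesz representation an interval around a value of the functional pulls back to the
  intersection of the half-spaces with normals \<open>v\<close> and \<open>-v\<close>.\<close>

lemma openin_tau_w_vimage:
  fixes f :: "'a::{real_inner,complete_space} \<Rightarrow> real"
  assumes "bounded_linear f" "open U"
  shows "openin tau_w (f -` U)"
proof (rule openin_subopen[THEN iffD2], rule ballI)
  fix z
  assume "z \<in> f -` U"
  then have "f z \<in> U" by simp
  then obtain e where e: "e > 0" "ball (f z) e \<subseteq> U"
    using openE[OF \<open>open U\<close>] by metis
  obtain v where v: "\<And>x. f x = x \<bullet> v"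
    using riesz_representation[OF assms(1)] by blast
  let ?S = "{y. y \<bullet> v < f z + e} \<inter> {y. y \<bullet> (- v) < - f z + e}"
  have "openin tau_w ?S"
    by (intro openin_Int) (simp_all only: openin_tau_w weakly_open_halfspace)
  moreover have "z \<in> ?S"
    using e(1) by (simp add: v)
  moreover have "?S \<subseteq> f -` U"
    using e(2) by (auto simp: v dist_real_def subset_iff abs_less_iff)
  ultimately show "\<exists>T. openin tau_w T \<and> z \<in> T \<and> T \<subseteq> f -` U"
    by blast
qed

lemma weak_topology_eq_tau_w: "(weak_topology :: 'a::{real_inner,complete_space} topology) = tau_w"
  unfolding topology_eq
proof (intro allI iffI)
  fix S :: "'a set"
  assume "openin weak_topology S"
  then have "generate_topology_on {f -` U | (f :: 'a \<Rightarrow> real) U. bounded_linear f \<and> open U} S"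
    unfolding weak_topology_def by (rule openin_topology_generated_by)
  then show "openin tau_w S"
  proof induction
    case (Basis S)
    then obtain f :: "'a \<Rightarrow> real" and U where "S = f -` U" "bounded_linear f" "open U"
      by blast
    then show ?case by (simp only: openin_tau_w_vimage)
  qed (simp_all add: openin_Int openin_Union)
next
  fix S :: "'a set"
  assume S: "openin tau_w S"
  show "openin weak_topology S"
  proof (rule openin_subopen[THEN iffD2], rule ballI)
    fix x
    assume "x \<in> S"
    then obtain \<epsilon> G where "\<epsilon> > 0" and G: "finite G" "G \<noteq> {}" "G \<subseteq> geodesics_from x"
      and sub: "(\<Inter>\<gamma>\<in>G. elementary_set x \<epsilon> \<gamma>) \<subseteq> S"
      using S unfolding openin_tau_w weakly_open_def by metis
    have "openin weak_topology (\<Inter>\<gamma>\<in>G. elementary_set x \<epsilon> \<gamma>)"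
      using G \<open>\<epsilon> > 0\<close> by (intro openin_INT2 openin_weak_topology_elementary_set) auto
    moreover have "x \<in> (\<Inter>\<gamma>\<in>G. elementary_set x \<epsilon> \<gamma>)"
      using G \<open>\<epsilon> > 0\<close> mem_elementary_set by blast
    ultimately show "\<exists>T. openin weak_topology T \<and> x \<in> T \<and> T \<subseteq> S"
      using sub by blast
  qed
qed

theorem proposition11:
  shows "weakly_proper TYPE('a::{real_inner,complete_space}) \<and>
         (weak_topology :: 'a topology) = tau_w"
proof
  show "weakly_proper TYPE('a)"
    unfolding weakly_proper_def
  proof (intro allI ballI impI)
    fix x :: 'a and \<gamma> and \<epsilon> :: real
    assume "\<gamma> \<in> geodesics_from x" "\<epsilon> > 0"
    then show "\<exists>V. openin tau_w V \<and> x \<in> V \<and> V \<subseteq> elementary_set x \<epsilon> \<gamma>"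
      by (intro exI[of _ "elementary_set x \<epsilon> \<gamma>"] conjI subset_refl
          openin_tau_w_elementary_set mem_elementary_set)
  qed
  show "(weak_topology :: 'a topology) = tau_w"
    by (rule weak_topology_eq_tau_w)
qed

end
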